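(* Let $\Lambda\in\{\mathsf{MSO},\mathsf{FO(TC^1)},\mathsf{FO(LFP^1)}\}$. The set of axioms T1–T10 together with all $\Lambda$-instances of the induction scheme Ind defines the class of finite trees: a (standard) structure $(M,<,\prec,P_1,\ldots,P_n)$ satisfies all these sentences if and only if it is a finite tree.
   Context: Standard semantics is used: $\mathsf{MSO}$ set quantifiers range over all subsets; $[TC_{xy}\varphi](u,v)$ holds under $g$ iff for every subset $A$ containing $g(u)$ and closed under $\varphi$ (i.e. $a\in A$ and $\varphi(a,b)$ imply $b\in A$) we have $g(v)\in A$; $[LFP_{Xx}\varphi]y$ (with $\varphi$ positive in the set variable $X$) holds iff $g(y)$ belongs to every subset $A$ such that every $a$ with $\varphi(a,A)$ lies in $A$. $\mathsf{FO(TC^1)}$ and $\mathsf{FO(LFP^1)}$ are the extensions of first-order logic with these respective operators, and $\mathsf{MSO}$ the extension with set variables and set quantifiers. A finite tree is a finite structure $(M,<,\prec,P_1,\ldots,P_n)$ ($P_i$ unary) where $(M,<)$ is a tree ($<$ the descendant relation, unique root, each non-root node has a unique immediate predecessor) and $\prec$ linearly orders the children of each node (relating only distinct children of a common node). Axioms (with $x\le y := x<y\vee x=y$, $x\preceq y:=x\prec y\vee x=y$, $x<_{ch}y := x<y\wedge\neg\exists z(z<y\wedge x<z)$, $x\prec_{ns}y:=x\prec y\wedge\neg\exists z(x\prec z\wedge z\prec y)$): T1 $\forall xyz(x<y\wedge y<z\to x<z)$; T2 $\neg\exists x(x<x)$; T3 $\forall xy(x<y\to\exists z(x<_{ch}z\wedge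 z\le y))$; T4 $\exists x\forall y(x\le y)$; T5 $\forall xyz(x<z\wedge y<z\to x\le y\vee y\le x)$; T6 $\forall xyz(x\prec y\wedge y\prec z\to x\prec z)$; T7 $\neg\exists x(x\prec x)$; T8 $\forall xy(x\prec y\to\exists z(x\prec_{ns}z\wedge z\preceq y))$; T9 $\forall x\exists y(y\preceq x\wedge\neg\exists z(z\prec y))$; T10 $\forall xy((x\prec y\vee y\prec x)\leftrightarrow(\exists z(z<_{ch}x\wedge z<_{ch}y)\wedge x\neq y))$; Ind: $\forall x(\forall y((x<y\vee x\prec y)\to\varphi(y))\to\varphi(x))\to\forall x\varphi(x)$ for every $\Lambda$-formula $\varphi(x)$ in one free variable $x$. *)

theory Defs
  imports Main
begin

text \<open>A structure $(M,<,\prec,P_1,\ldots,P_n)$; only the labels with index in \<open>{1..n}\<close> are relevant.\<close>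

record 'a tree_struct =
  univ :: "'a set"
  desc :: "('a \<times> 'a) set"
  sib  :: "('a \<times> 'a) set"
  lab  :: "nat \<Rightarrow> 'a set"

definition is_structure :: "nat \<Rightarrow> 'a tree_struct \<Rightarrow> bool" where
  "is_structure n S \<longleftrightarrow>
     univ S \<noteq> {} \<and>
     desc S \<subseteq> univ S \<times> univ S \<and>
     sib S \<subseteq> univ S \<times> univ S \<and>
     (\<forall>i\<in>{1..n}. lab S i \<subseteq> univ S)"

definition child_rel :: "'a set \<Rightarrow> ('a \<times> 'a) set \<Rightarrow> ('a \<times> 'a) set" where
  "child_rel M lt = {(x, y) \<in> lt. x \<in> M \<and> y \<in> M \<and> \<not> (\<exists>z\<in>M. (x, z) \<in> lt \<and> (z, y) \<in> lt)}"

definition is_root :: "'a set \<Rightarrow> ('a \<times> 'a) set \<Rightarrow> 'a \<Rightarrow> bool" where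
  "is_root M lt r \<longleftrightarrow> r \<in> M \<and> (\<forall>x\<in>M. x \<noteq> r \<longrightarrow> (r, x) \<in> lt)"

text \<open>That \<open>lt\<close> is the descendant relation is the requirement that it is the transitive closure
  of its immediate-predecessor relation.\<close>

definition is_tree :: "'a set \<Rightarrow> ('a \<times> 'a) set \<Rightarrow> bool" where
  "is_tree M lt \<longleftrightarrow>
     irrefl lt \<and> trans lt \<and> lt = (child_rel M lt)\<^sup>+ \<and>
     (\<exists>!r. is_root M lt r) \<and>
     (\<forall>x\<in>M. \<not> is_root M lt x \<longrightarrow> (\<exists>!p. (p, x) \<in> child_rel M lt))"

definition children :: "'a tree_struct \<Rightarrow> 'a \<Rightarrow> 'a set" where
  "children S z = {x. (z, x) \<in> child_rel (univ S) (desc S)}"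

definition finite_tree :: "'a tree_struct \<Rightarrow> bool" where
  "finite_tree S \<longleftrightarrow>
     finite (univ S) \<and>
     is_tree (univ S) (desc S) \<and>
     (\<forall>z\<in>univ S. strict_linear_order_on (children S z)
                    (sib S \<inter> children S z \<times> children S z)) \<and>
     (\<forall>(x, y)\<in>sib S. x \<noteq> y \<and> (\<exists>z\<in>univ S. x \<in> children S z \<and> y \<in> children S z))"

text \<open>One syntax for all three logics; \<open>is_formula\<close> below carves out the formulas of each.
  Element variables and set variables are two separate sorts, both named by natural numbers.
  \<open>TC x y \<phi> u v\<close> is $[TC_{xy}\varphi](u,v)$ and \<open>LFP X x \<phi> y\<close> is $[LFP_{Xx}\varphi]y$; in both,
  \<open>\<phi>\<close> may contain further free variables as parameters.\<close>

datatype fm =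
    Eq nat nat
  | Lt nat nat
  | Prec nat nat
  | Lab nat nat
  | Mem nat nat
  | Neg fm  ("\<^bold>\<not> _" [140] 140)
  | And fm fm  (infixr "\<^bold>\<and>" 135)
  | Or fm fm  (infixr "\<^bold>\<or>" 130)
  | Imp fm fm  (infixr "\<^bold>\<longrightarrow>" 125)
  | Ex nat fm
  | All nat fm
  | ExSet nat fm
  | AllSet nat fm
  | TC nat nat fm nat nat
  | LFP nat nat fm nat

primrec vars :: "fm \<Rightarrow> nat set" where
  "vars (Eq x y) = {x, y}"
| "vars (Lt x y) = {x, y}"
| "vars (Prec x y) = {x, y}"
| "vars (Lab i x) = {x}"
| "vars (Mem X x) = {x}"
| "vars (\<^bold>\<not> \<phi>) = vars \<phi>"
| "vars (\<phi> \<^bold>\<and> \<psi>) = vars \<phi> \<union> vars \<psi>"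
| "vars (\<phi> \<^bold>\<or> \<psi>) = vars \<phi> \<union> vars \<psi>"
| "vars (\<phi> \<^bold>\<longrightarrow> \<psi>) = vars \<phi> \<union> vars \<psi>"
| "vars (Ex x \<phi>) = insert x (vars \<phi>)"
| "vars (All x \<phi>) = insert x (vars \<phi>)"
| "vars (ExSet X \<phi>) = vars \<phi>"
| "vars (AllSet X \<phi>) = vars \<phi>"
| "vars (TC x y \<phi> u v) = {x, y, u, v} \<union> vars \<phi>"
| "vars (LFP X x \<phi> y) = {x, y} \<union> vars \<phi>"

primrec free_vars :: "fm \<Rightarrow> nat set" where
  "free_vars (Eq x y) = {x, y}"
| "free_vars (Lt x y) = {x, y}"
| "free_vars (Prec x y) = {x, y}"
| "free_vars (Lab i x) = {x}"
| "free_vars (Mem X x) = {x}"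
| "free_vars (\<^bold>\<not> \<phi>) = free_vars \<phi>"
| "free_vars (\<phi> \<^bold>\<and> \<psi>) = free_vars \<phi> \<union> free_vars \<psi>"
| "free_vars (\<phi> \<^bold>\<or> \<psi>) = free_vars \<phi> \<union> free_vars \<psi>"
| "free_vars (\<phi> \<^bold>\<longrightarrow> \<psi>) = free_vars \<phi> \<union> free_vars \<psi>"
| "free_vars (Ex x \<phi>) = free_vars \<phi> - {x}"
| "free_vars (All x \<phi>) = free_vars \<phi> - {x}"
| "free_vars (ExSet X \<phi>) = free_vars \<phi>"
| "free_vars (AllSet X \<phi>) = free_vars \<phi>"
| "free_vars (TC x y \<phi> u v) = (free_vars \<phi> - {x, y}) \<union> {u, v}"
| "free_vars (LFP X x \<phi> y) = (free_vars \<phi> - {x}) \<union> {y}"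

primrec free_set_vars :: "fm \<Rightarrow> nat set" where
  "free_set_vars (Eq x y) = {}"
| "free_set_vars (Lt x y) = {}"
| "free_set_vars (Prec x y) = {}"
| "free_set_vars (Lab i x) = {}"
| "free_set_vars (Mem X x) = {X}"
| "free_set_vars (\<^bold>\<not> \<phi>) = free_set_vars \<phi>"
| "free_set_vars (\<phi> \<^bold>\<and> \<psi>) = free_set_vars \<phi> \<union> free_set_vars \<psi>"
| "free_set_vars (\<phi> \<^bold>\<or> \<psi>) = free_set_vars \<phi> \<union> free_set_vars \<psi>"
| "free_set_vars (\<phi> \<^bold>\<longrightarrow> \<psi>) = free_set_vars \<phi> \<union> free_set_vars \<psi>"
| "free_set_vars (Ex x \<phi>) = free_set_vars \<phi>"
| "free_set_vars (All x \<phi>) = free_set_vars \<phi>"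
| "free_set_vars (ExSet X \<phi>) = free_set_vars \<phi> - {X}"
| "free_set_vars (AllSet X \<phi>) = free_set_vars \<phi> - {X}"
| "free_set_vars (TC x y \<phi> u v) = free_set_vars \<phi>"
| "free_set_vars (LFP X x \<phi> y) = free_set_vars \<phi> - {X}"

text \<open>\<open>polarity X b \<phi>\<close>: every free occurrence of \<open>X\<close> in \<open>\<phi>\<close> is positive (\<open>b = True\<close>),
  respectively negative (\<open>b = False\<close>).\<close>

primrec polarity :: "nat \<Rightarrow> bool \<Rightarrow> fm \<Rightarrow> bool" where
  "polarity X b (Eq x y) \<longleftrightarrow> True"
| "polarity X b (Lt x y) \<longleftrightarrow> True"
| "polarity X b (Prec x y) \<longleftrightarrow> True"
| "polarity X b (Lab i x) \<longleftrightarrow> True"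
| "polarity X b (Mem Y x) \<longleftrightarrow> (Y = X \<longrightarrow> b)"
| "polarity X b (\<^bold>\<not> \<phi>) \<longleftrightarrow> polarity X (\<not> b) \<phi>"
| "polarity X b (\<phi> \<^bold>\<and> \<psi>) \<longleftrightarrow> polarity X b \<phi> \<and> polarity X b \<psi>"
| "polarity X b (\<phi> \<^bold>\<or> \<psi>) \<longleftrightarrow> polarity X b \<phi> \<and> polarity X b \<psi>"
| "polarity X b (\<phi> \<^bold>\<longrightarrow> \<psi>) \<longleftrightarrow> polarity X (\<not> b) \<phi> \<and> polarity X b \<psi>"
| "polarity X b (Ex x \<phi>) \<longleftrightarrow> polarity X b \<phi>"
| "polarity X b (All x \<phi>) \<longleftrightarrow> polarity X b \<phi>"
| "polarity X b (ExSet Y \<phi>) \<longleftrightarrow> Y = X \<or> polarity X b \<phi>"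
| "polarity X b (AllSet Y \<phi>) \<longleftrightarrow> Y = X \<or> polarity X b \<phi>"
| "polarity X b (TC x y \<phi> u v) \<longleftrightarrow> polarity X b \<phi>"
| "polarity X b (LFP Y x \<phi> y) \<longleftrightarrow> Y = X \<or> polarity X b \<phi>"

datatype tree_logic = MSO | FO_TC1 | FO_LFP1

text \<open>\<open>is_formula L n \<phi>\<close>: \<open>\<phi>\<close> is an \<open>L\<close>-formula over the vocabulary $<,\prec,P_1,\ldots,P_n$.\<close>

primrec is_formula :: "tree_logic \<Rightarrow> nat \<Rightarrow> fm \<Rightarrow> bool" where
  "is_formula L n (Eq x y) \<longleftrightarrow> True"
| "is_formula L n (Lt x y) \<longleftrightarrow> True"
| "is_formula L n (Prec x y) \<longleftrightarrow> True"
| "is_formula L n (Lab i x) \<longleftrightarrow> i \<in> {1..n}"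
| "is_formula L n (Mem X x) \<longleftrightarrow> L = MSO \<or> L = FO_LFP1"
| "is_formula L n (\<^bold>\<not> \<phi>) \<longleftrightarrow> is_formula L n \<phi>"
| "is_formula L n (\<phi> \<^bold>\<and> \<psi>) \<longleftrightarrow> is_formula L n \<phi> \<and> is_formula L n \<psi>"
| "is_formula L n (\<phi> \<^bold>\<or> \<psi>) \<longleftrightarrow> is_formula L n \<phi> \<and> is_formula L n \<psi>"
| "is_formula L n (\<phi> \<^bold>\<longrightarrow> \<psi>) \<longleftrightarrow> is_formula L n \<phi> \<and> is_formula L n \<psi>"
| "is_formula L n (Ex x \<phi>) \<longleftrightarrow> is_formula L n \<phi>"
| "is_formula L n (All x \<phi>) \<longleftrightarrow> is_formula L n \<phi>"
| "is_formula L n (ExSet X \<phi>) \<longleftrightarrow> L = MSO \<and> is_formula L n \<phi>"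
| "is_formula L n (AllSet X \<phi>) \<longleftrightarrow> L = MSO \<and> is_formula L n \<phi>"
| "is_formula L n (TC x y \<phi> u v) \<longleftrightarrow> L = FO_TC1 \<and> x \<noteq> y \<and> is_formula L n \<phi>"
| "is_formula L n (LFP X x \<phi> y) \<longleftrightarrow> L = FO_LFP1 \<and> polarity X True \<phi> \<and> is_formula L n \<phi>"

text \<open>\<open>subst x y \<phi>\<close> replaces the free occurrences of \<open>x\<close> by \<open>y\<close>. It does not rename bound
  variables, so it is only used for \<open>y \<notin> vars \<phi>\<close>.\<close>

abbreviation rn :: "nat \<Rightarrow> nat \<Rightarrow> nat \<Rightarrow> nat" where
  "rn x y v \<equiv> (if v = x then y else v)"

primrec subst :: "nat \<Rightarrow> nat \<Rightarrow> fm \<Rightarrow> fm" where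
  "subst x y (Eq u v) = Eq (rn x y u) (rn x y v)"
| "subst x y (Lt u v) = Lt (rn x y u) (rn x y v)"
| "subst x y (Prec u v) = Prec (rn x y u) (rn x y v)"
| "subst x y (Lab i u) = Lab i (rn x y u)"
| "subst x y (Mem X u) = Mem X (rn x y u)"
| "subst x y (\<^bold>\<not> \<phi>) = \<^bold>\<not> (subst x y \<phi>)"
| "subst x y (\<phi> \<^bold>\<and> \<psi>) = (subst x y \<phi> \<^bold>\<and> subst x y \<psi>)"
| "subst x y (\<phi> \<^bold>\<or> \<psi>) = (subst x y \<phi> \<^bold>\<or> subst x y \<psi>)"
| "subst x y (\<phi> \<^bold>\<longrightarrow> \<psi>) = (subst x y \<phi> \<^bold>\<longrightarrow> subst x y \<psi>)"
| "subst x y (Ex u \<phi>) = Ex u (if u = x then \<phi> else subst x y \<phi>)"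
| "subst x y (All u \<phi>) = All u (if u = x then \<phi> else subst x y \<phi>)"
| "subst x y (ExSet X \<phi>) = ExSet X (subst x y \<phi>)"
| "subst x y (AllSet X \<phi>) = AllSet X (subst x y \<phi>)"
| "subst x y (TC u v \<phi> s t) =
     TC u v (if x \<in> {u, v} then \<phi> else subst x y \<phi>) (rn x y s) (rn x y t)"
| "subst x y (LFP X u \<phi> s) = LFP X u (if u = x then \<phi> else subst x y \<phi>) (rn x y s)"

primrec sat :: "'a tree_struct \<Rightarrow> (nat \<Rightarrow> 'a) \<Rightarrow> (nat \<Rightarrow> 'a set) \<Rightarrow> fm \<Rightarrow> bool" where
  "sat S g G (Eq x y) \<longleftrightarrow> g x = g y"
| "sat S g G (Lt x y) \<longleftrightarrow> (g x, g y) \<in> desc S"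
| "sat S g G (Prec x y) \<longleftrightarrow> (g x, g y) \<in> sib S"
| "sat S g G (Lab i x) \<longleftrightarrow> g x \<in> lab S i"
| "sat S g G (Mem X x) \<longleftrightarrow> g x \<in> G X"
| "sat S g G (\<^bold>\<not> \<phi>) \<longleftrightarrow> \<not> sat S g G \<phi>"
| "sat S g G (\<phi> \<^bold>\<and> \<psi>) \<longleftrightarrow> sat S g G \<phi> \<and> sat S g G \<psi>"
| "sat S g G (\<phi> \<^bold>\<or> \<psi>) \<longleftrightarrow> sat S g G \<phi> \<or> sat S g G \<psi>"
| "sat S g G (\<phi> \<^bold>\<longrightarrow> \<psi>) \<longleftrightarrow> (sat S g G \<phi> \<longrightarrow> sat S g G \<psi>)"
| "sat S g G (Ex x \<phi>) \<longleftrightarrow> (\<exists>a\<in>univ S. sat S (g(x := a)) G \<phi>)"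
| "sat S g G (All x \<phi>) \<longleftrightarrow> (\<forall>a\<in>univ S. sat S (g(x := a)) G \<phi>)"
| "sat S g G (ExSet X \<phi>) \<longleftrightarrow> (\<exists>A\<subseteq>univ S. sat S g (G(X := A)) \<phi>)"
| "sat S g G (AllSet X \<phi>) \<longleftrightarrow> (\<forall>A\<subseteq>univ S. sat S g (G(X := A)) \<phi>)"
| "sat S g G (TC x y \<phi> u v) \<longleftrightarrow>
     (\<forall>A\<subseteq>univ S. g u \<in> A \<and>
        (\<forall>a\<in>univ S. \<forall>b\<in>univ S. a \<in> A \<and> sat S (g(x := a, y := b)) G \<phi> \<longrightarrow> b \<in> A) \<longrightarrow> g v \<in> A)"
| "sat S g G (LFP X x \<phi> y) \<longleftrightarrow>
     (\<forall>A\<subseteq>univ S. (\<forall>a\<in>univ S. sat S (g(x := a)) (G(X := A)) \<phi> \<longrightarrow> a \<in> A) \<longrightarrow> g y \<in> A)"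

definition models :: "'a tree_struct \<Rightarrow> fm \<Rightarrow> bool"  (infix "\<Turnstile>" 50) where
  "S \<Turnstile> \<phi> \<longleftrightarrow>
     (\<forall>g G. (\<forall>v. g v \<in> univ S) \<and> (\<forall>X. G X \<subseteq> univ S) \<longrightarrow> sat S g G \<phi>)"

definition Iff :: "fm \<Rightarrow> fm \<Rightarrow> fm"  (infixr "\<^bold>\<longleftrightarrow>" 125) where
  "(\<phi> \<^bold>\<longleftrightarrow> \<psi>) = ((\<phi> \<^bold>\<longrightarrow> \<psi>) \<^bold>\<and> (\<psi> \<^bold>\<longrightarrow> \<phi>))"

definition Le :: "nat \<Rightarrow> nat \<Rightarrow> fm" where
  "Le x y = (Lt x y \<^bold>\<or> Eq x y)"

definition PrecEq :: "nat \<Rightarrow> nat \<Rightarrow> fm" where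
  "PrecEq x y = (Prec x y \<^bold>\<or> Eq x y)"

text \<open>$x <_{ch} y$ and $x \prec_{ns} y$; the first argument \<open>z\<close> names the bound variable and has to
  be distinct from \<open>x\<close> and \<open>y\<close>.\<close>

definition LtCh :: "nat \<Rightarrow> nat \<Rightarrow> nat \<Rightarrow> fm" where
  "LtCh z x y = (Lt x y \<^bold>\<and> \<^bold>\<not> Ex z (Lt z y \<^bold>\<and> Lt x z))"

definition PrecNs :: "nat \<Rightarrow> nat \<Rightarrow> nat \<Rightarrow> fm" where
  "PrecNs z x y = (Prec x y \<^bold>\<and> \<^bold>\<not> Ex z (Prec x z \<^bold>\<and> Prec z y))"

text \<open>In the axioms the variables $x,y,z$ are \<open>0, 1, 2\<close>, and \<open>3\<close> is the variable bound inside
  \<open>LtCh\<close> and \<open>PrecNs\<close>.\<close>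

definition T1 :: fm where
  "T1 = All 0 (All 1 (All 2 (Lt 0 1 \<^bold>\<and> Lt 1 2 \<^bold>\<longrightarrow> Lt 0 2)))"

definition T2 :: fm where
  "T2 = \<^bold>\<not> Ex 0 (Lt 0 0)"

definition T3 :: fm where
  "T3 = All 0 (All 1 (Lt 0 1 \<^bold>\<longrightarrow> Ex 2 (LtCh 3 0 2 \<^bold>\<and> Le 2 1)))"

definition T4 :: fm where
  "T4 = Ex 0 (All 1 (Le 0 1))"

definition T5 :: fm where
  "T5 = All 0 (All 1 (All 2 (Lt 0 2 \<^bold>\<and> Lt 1 2 \<^bold>\<longrightarrow> Le 0 1 \<^bold>\<or> Le 1 0)))"

definition T6 :: fm where
  "T6 = All 0 (All 1 (All 2 (Prec 0 1 \<^bold>\<and> Prec 1 2 \<^bold>\<longrightarrow> Prec 0 2)))"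

definition T7 :: fm where
  "T7 = \<^bold>\<not> Ex 0 (Prec 0 0)"

definition T8 :: fm where
  "T8 = All 0 (All 1 (Prec 0 1 \<^bold>\<longrightarrow> Ex 2 (PrecNs 3 0 2 \<^bold>\<and> PrecEq 2 1)))"

definition T9 :: fm where
  "T9 = All 0 (Ex 1 (PrecEq 1 0 \<^bold>\<and> \<^bold>\<not> Ex 2 (Prec 2 1)))"

definition T10 :: fm where
  "T10 = All 0 (All 1
     (Prec 0 1 \<^bold>\<or> Prec 1 0 \<^bold>\<longleftrightarrow> Ex 2 (LtCh 3 2 0 \<^bold>\<and> LtCh 3 2 1) \<^bold>\<and> \<^bold>\<not> Eq 0 1))"

text \<open>The instance of the induction scheme for \<open>\<phi>(x)\<close>, where \<open>y\<close> is a fresh variable.\<close>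

definition Ind :: "nat \<Rightarrow> nat \<Rightarrow> fm \<Rightarrow> fm" where
  "Ind x y \<phi> =
     (All x (All y (Lt x y \<^bold>\<or> Prec x y \<^bold>\<longrightarrow> subst x y \<phi>) \<^bold>\<longrightarrow> \<phi>) \<^bold>\<longrightarrow> All x \<phi>)"

definition tree_axioms :: "tree_logic \<Rightarrow> nat \<Rightarrow> fm set" where
  "tree_axioms L n =
     {T1, T2, T3, T4, T5, T6, T7, T8, T9, T10} \<union>
     {Ind x y \<phi> | x y \<phi>. is_formula L n \<phi> \<and> free_vars \<phi> \<subseteq> {x} \<and> free_set_vars \<phi> = {} \<and>
                          y \<noteq> x \<and> y \<notin> vars \<phi>}"

end

theory Submission imports Defs begin

text \<open>For a node \<open>v\<close> let \<open>pre v\<close> be the set of nodes visited up to \<open>v\<close> by the preorder traversal, a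
  first-order definable set, and let \<open>u\<close> step to \<open>v\<close> if \<open>pre v \<subseteq> pre u \<union> {v}\<close>. Steps preserve
  finiteness of \<open>pre\<close>. Each of the three logics can express that some \<open>z\<close> is reachable from \<open>x\<close> by
  steps and that \<open>pre z\<close> contains \<open>pre x\<close> and the subtrees of \<open>x\<close> and of its right siblings: go
  through the subtree of \<open>x\<close> starting from its first child, then continue with the next sibling.
  This property satisfies the premise of Ind, so it holds at the root \<open>r\<close>, where \<open>pre r = {r}\<close>; hence
  the whole structure is finite. Conversely, in a finite tree the union of \<open><\<close> and \<open>\<prec>\<close> is conversely
  well-founded, because \<open>x < y \<prec> z\<close> implies \<open>x < z\<close>.\<close>

section \<open>Substitution\<close>

text \<open>Stated for all occurring variables rather than only the free ones, which keeps the
  binder cases immediate; it serves to discard the value of a variable that does not occur at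
  all.\<close>

lemma sat_cong_vars:
  "(\<forall>v\<in>vars \<phi>. g v = h v) \<Longrightarrow> sat S g G \<phi> \<longleftrightarrow> sat S h G \<phi>"
proof (induction \<phi> arbitrary: g h G)
  case (Ex x \<phi>)
  have "sat S (g(x := a)) G \<phi> \<longleftrightarrow> sat S (h(x := a)) G \<phi>" for a
    using Ex.prems by (intro Ex.IH) auto
  then show ?case by simp
next
  case (All x \<phi>)
  have "sat S (g(x := a)) G \<phi> \<longleftrightarrow> sat S (h(x := a)) G \<phi>" for a
    using All.prems by (intro All.IH) auto
  then show ?case by simp
next
  case (ExSet X \<phi>)
  have "sat S g H \<phi> \<longleftrightarrow> sat S h H \<phi>" for H
    using ExSet.prems by (intro ExSet.IH) auto
  then show ?case by simp
next
  case (AllSet X \<phi>)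
  have "sat S g H \<phi> \<longleftrightarrow> sat S h H \<phi>" for H
    using AllSet.prems by (intro AllSet.IH) auto
  then show ?case by simp
next
  case (TC x y \<phi> u v)
  have "sat S (g(x := a, y := b)) G \<phi> \<longleftrightarrow> sat S (h(x := a, y := b)) G \<phi>" for a b
    using TC.prems by (intro TC.IH) auto
  then show ?case using TC.prems by simp
next
  case (LFP X x \<phi> y)
  have "sat S (g(x := a)) H \<phi> \<longleftrightarrow> sat S (h(x := a)) H \<phi>" for a H
    using LFP.prems by (intro LFP.IH) auto
  then show ?case using LFP.prems by simp
next
  case (Neg \<phi>)
  then show ?case by (metis sat.simps(6) vars.simps(6))
next
  case (And \<phi> \<psi>)
  then show ?case by (metis UnCI sat.simps(7) vars.simps(7))
next
  case (Or \<phi> \<psi>)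
  then show ?case by (metis UnCI sat.simps(8) vars.simps(8))
next
  case (Imp \<phi> \<psi>)
  then show ?case by (metis UnCI sat.simps(9) vars.simps(9))
qed simp_all

text \<open>No binder of the formula can capture \<open>y\<close>, so the update of \<open>x\<close>
  commutes with that of any other bound variable. Below a binder of \<open>x\<close> the
  substitution stops, and there the update of \<open>x\<close> is overwritten.\<close>

lemma sat_subst:
  "y \<notin> vars \<phi> \<Longrightarrow> sat S g G (subst x y \<phi>) \<longleftrightarrow> sat S (g(x := g y)) G \<phi>"
proof (induction \<phi> arbitrary: g G)
  case (Ex u \<phi>)
  have "sat S (g(u := a)) G (if u = x then \<phi> else subst x y \<phi>)
    \<longleftrightarrow> sat S (g(x := g y, u := a)) G \<phi>" for a
  proof (cases "u = x")
    case False
    have "sat S (g(u := a)) G (subst x y \<phi>) \<longleftrightarrow> sat S (g(u := a, x := (g(u := a)) y)) G \<phi>"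
      using Ex.prems by (intro Ex.IH) simp
    also have "g(u := a, x := (g(u := a)) y) = g(x := g y, u := a)"
      using False Ex.prems by (auto simp: fun_eq_iff)
    finally show ?thesis by (subst if_not_P[OF False])
  qed simp
  then show ?case by (simp only: subst.simps sat.simps)
next
  case (All u \<phi>)
  have "sat S (g(u := a)) G (if u = x then \<phi> else subst x y \<phi>)
    \<longleftrightarrow> sat S (g(x := g y, u := a)) G \<phi>" for a
  proof (cases "u = x")
    case False
    have "sat S (g(u := a)) G (subst x y \<phi>) \<longleftrightarrow> sat S (g(u := a, x := (g(u := a)) y)) G \<phi>"
      using All.prems by (intro All.IH) simp
    also have "g(u := a, x := (g(u := a)) y) = g(x := g y, u := a)"
      using False All.prems by (auto simp: fun_eq_iff)
    finally show ?thesis by (subst if_not_P[OF False])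
  qed simp
  then show ?case by (simp only: subst.simps sat.simps)
next
  case (TC u v \<phi> s t)
  have rn: "(g(x := g y)) s = g (rn x y s)" "(g(x := g y)) t = g (rn x y t)" by simp_all
  have "sat S (g(u := a, v := b)) G (if x \<in> {u, v} then \<phi> else subst x y \<phi>)
    \<longleftrightarrow> sat S (g(x := g y, u := a, v := b)) G \<phi>" for a b
  proof (cases "x \<in> {u, v}")
    case True
    then have "g(x := g y, u := a, v := b) = g(u := a, v := b)" by (auto simp: fun_eq_iff)
    with True show ?thesis by simp
  next
    case False
    let ?h = "g(u := a, v := b)"
    have "sat S ?h G (subst x y \<phi>) \<longleftrightarrow> sat S (?h(x := ?h y)) G \<phi>"
      using TC.prems by (intro TC.IH) simp
    also have "?h(x := ?h y) = g(x := g y, u := a, v := b)"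
      using False TC.prems by (auto simp: fun_eq_iff)
    finally show ?thesis by (subst if_not_P[OF False])
  qed
  then show ?case by (simp only: subst.simps sat.simps rn)
next
  case (LFP X u \<phi> s)
  have rn: "(g(x := g y)) s = g (rn x y s)" by simp
  have "sat S (g(u := a)) H (if u = x then \<phi> else subst x y \<phi>)
    \<longleftrightarrow> sat S (g(x := g y, u := a)) H \<phi>" for a H
  proof (cases "u = x")
    case False
    have "sat S (g(u := a)) H (subst x y \<phi>) \<longleftrightarrow> sat S (g(u := a, x := (g(u := a)) y)) H \<phi>"
      using LFP.prems by (intro LFP.IH) simp
    also have "g(u := a, x := (g(u := a)) y) = g(x := g y, u := a)"
      using False LFP.prems by (auto simp: fun_eq_iff)
    finally show ?thesis by (subst if_not_P[OF False])
  qed simp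
  then show ?case by (simp only: subst.simps sat.simps rn)
qed simp_all

text \<open>Substitution and fresh variable disappear: what remains is plain induction from
  descendants and later siblings, the form in which both directions of the theorem use the
  scheme.\<close>

lemma sat_Ind:
  assumes "y \<noteq> x" "y \<notin> vars \<phi>"
  shows "sat S g G (Ind x y \<phi>) \<longleftrightarrow>
    ((\<forall>a\<in>univ S. (\<forall>b\<in>univ S. (a, b) \<in> desc S \<union> sib S \<longrightarrow> sat S (g(x := b)) G \<phi>)
        \<longrightarrow> sat S (g(x := a)) G \<phi>)
      \<longrightarrow> (\<forall>a\<in>univ S. sat S (g(x := a)) G \<phi>))"
proof -
  have "sat S (g(x := a, y := b)) G (subst x y \<phi>) \<longleftrightarrow> sat S (g(x := b)) G \<phi>" for a b
    using assms sat_cong_vars[of \<phi> "g(x := a, y := b, x := b)" "g(x := b)"]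
    by (auto simp: sat_subst)
  with assms show ?thesis by (simp add: Ind_def)
qed

section \<open>The first-order axioms\<close>

text \<open>The content of T1 to T10. The natural numbers with their usual order and no sibling
  pairs are an infinite instance, so finiteness has to come from Ind.\<close>

locale discrete_tree =
  fixes S :: "'a tree_struct"
  assumes desc_subset: "desc S \<subseteq> univ S \<times> univ S"
    and sib_subset: "sib S \<subseteq> univ S \<times> univ S"
    and desc_trans: "trans (desc S)"
    and desc_irrefl: "irrefl (desc S)"
    and desc_child: "(x, y) \<in> desc S \<Longrightarrow>
      \<exists>z. (x, z) \<in> child_rel (univ S) (desc S) \<and> (z, y) \<in> (desc S)\<^sup>="
    and root: "\<exists>r\<in>univ S. \<forall>x\<in>univ S. (r, x) \<in> (desc S)\<^sup>="
    and ancestors_linear: "(x, z) \<in> desc S \<Longrightarrow> (y, z) \<in> desc S \<Longrightarrow>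
      (x, y) \<in> (desc S)\<^sup>= \<or> (y, x) \<in> (desc S)\<^sup>="
    and sib_trans: "trans (sib S)"
    and sib_irrefl: "irrefl (sib S)"
    and sib_next: "(x, y) \<in> sib S \<Longrightarrow>
      \<exists>z. (x, z) \<in> sib S \<and> (\<nexists>w. (x, w) \<in> sib S \<and> (w, z) \<in> sib S) \<and> (z, y) \<in> (sib S)\<^sup>="
    and sib_first: "x \<in> univ S \<Longrightarrow> \<exists>y. (y, x) \<in> (sib S)\<^sup>= \<and> (\<nexists>z. (z, y) \<in> sib S)"
    and sib_iff: "x \<in> univ S \<Longrightarrow> y \<in> univ S \<Longrightarrow>
      (x, y) \<in> sib S \<or> (y, x) \<in> sib S \<longleftrightarrow>
      (\<exists>z. (z, x) \<in> child_rel (univ S) (desc S) \<and> (z, y) \<in> child_rel (univ S) (desc S)) \<and> x \<noteq> y"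

lemma models_first_order_axioms:
  assumes "is_structure n S"
  shows "(\<forall>\<psi>\<in>{T1, T2, T3, T4, T5, T6, T7, T8, T9, T10}. S \<Turnstile> \<psi>) \<longleftrightarrow> discrete_tree S"
proof -
  define M where "M = univ S"
  obtain m where m: "m \<in> M"
    using assms by (auto simp: is_structure_def M_def)
  \<comment> \<open>The axioms are sentences, so the quantification over assignments in
    \<open>models\<close> collapses once some assignment into the universe exists.\<close>
  then have const: "\<exists>g::nat \<Rightarrow> 'a. \<forall>v. g v \<in> M" "\<exists>G::nat \<Rightarrow> 'a set. \<forall>X. G X \<subseteq> M"
    by (auto intro: exI[of _ "\<lambda>_. m"] exI[of _ "\<lambda>_. {}"])
  have d: "(x, y) \<in> desc S \<Longrightarrow> x \<in> M \<and> y \<in> M" for x y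
    using assms by (auto simp: is_structure_def M_def)
  have s: "(x, y) \<in> sib S \<Longrightarrow> x \<in> M \<and> y \<in> M" for x y
    using assms by (auto simp: is_structure_def M_def)
  have ch: "(x, y) \<in> child_rel M (desc S) \<longleftrightarrow>
      (x, y) \<in> desc S \<and> \<not> (\<exists>z\<in>M. (z, y) \<in> desc S \<and> (x, z) \<in> desc S)" for x y
    using d by (auto simp: child_rel_def)
  have 1: "S \<Turnstile> T1 \<longleftrightarrow> trans (desc S)"
    using d unfolding models_def T1_def by (simp add: const trans_def flip: M_def) blast
  have 2: "S \<Turnstile> T2 \<longleftrightarrow> irrefl (desc S)"
    using d unfolding models_def T2_def by (simp add: const irrefl_def flip: M_def) blast
  have 3: "S \<Turnstile> T3 \<longleftrightarrow> (\<forall>x y. (x, y) \<in> desc S \<longrightarrow>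
      (\<exists>z. (x, z) \<in> child_rel M (desc S) \<and> (z, y) \<in> (desc S)\<^sup>=))"
    using d unfolding models_def T3_def
    by (simp add: const ch LtCh_def Le_def flip: M_def) blast
  have 4: "S \<Turnstile> T4 \<longleftrightarrow> (\<exists>r\<in>M. \<forall>x\<in>M. (r, x) \<in> (desc S)\<^sup>=)"
    unfolding models_def T4_def by (simp add: const Le_def disj_commute flip: M_def)
  have 5: "S \<Turnstile> T5 \<longleftrightarrow> (\<forall>x z y. (x, z) \<in> desc S \<longrightarrow> (y, z) \<in> desc S \<longrightarrow>
      (x, y) \<in> (desc S)\<^sup>= \<or> (y, x) \<in> (desc S)\<^sup>=)"
    using d unfolding models_def T5_def by (simp add: const Le_def flip: M_def) blast
  have 6: "S \<Turnstile> T6 \<longleftrightarrow> trans (sib S)"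
    using s unfolding models_def T6_def by (simp add: const trans_def flip: M_def) blast
  have 7: "S \<Turnstile> T7 \<longleftrightarrow> irrefl (sib S)"
    using s unfolding models_def T7_def by (simp add: const irrefl_def flip: M_def) blast
  define ns where "ns x y \<longleftrightarrow> (x, y) \<in> sib S \<and> \<not> (\<exists>w\<in>M. (x, w) \<in> sib S \<and> (w, y) \<in> sib S)" for x y
  have ns_iff: "ns x y \<longleftrightarrow> (x, y) \<in> sib S \<and> (\<nexists>w. (x, w) \<in> sib S \<and> (w, y) \<in> sib S)"
    and ns_M: "ns x y \<Longrightarrow> y \<in> M" for x y
    using s by (auto simp: ns_def)
  have "sat S g G (PrecNs 3 0 2) \<longleftrightarrow> ns (g 0) (g 2)" for g G
    by (simp add: PrecNs_def ns_def flip: M_def)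
  then have "S \<Turnstile> T8 \<longleftrightarrow> (\<forall>x y. (x, y) \<in> sib S \<longrightarrow> (\<exists>z. ns x z \<and> (z, y) \<in> (sib S)\<^sup>=))"
    using s ns_M unfolding models_def T8_def
    by (simp add: const PrecEq_def flip: M_def) blast
  then have 8: "S \<Turnstile> T8 \<longleftrightarrow> (\<forall>x y. (x, y) \<in> sib S \<longrightarrow>
      (\<exists>z. (x, z) \<in> sib S \<and> (\<nexists>w. (x, w) \<in> sib S \<and> (w, z) \<in> sib S) \<and> (z, y) \<in> (sib S)\<^sup>=))"
    by (simp only: ns_iff conj_assoc)
  have first: "(\<forall>z\<in>M. (z, y) \<notin> sib S) \<longleftrightarrow> (\<nexists>z. (z, y) \<in> sib S)" for y
    using s by blast
  have 9: "S \<Turnstile> T9 \<longleftrightarrow>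
      (\<forall>x\<in>M. \<exists>y. (y, x) \<in> (sib S)\<^sup>= \<and> (\<nexists>z. (z, y) \<in> sib S))"
    unfolding models_def T9_def by (simp add: const PrecEq_def first flip: M_def) (metis s)
  have "sat S g G (Ex 2 (LtCh 3 2 0 \<^bold>\<and> LtCh 3 2 1)) \<longleftrightarrow>
      (\<exists>z. (z, g 0) \<in> child_rel M (desc S) \<and> (z, g 1) \<in> child_rel M (desc S))" for g G
    using d by (auto simp: ch LtCh_def simp flip: M_def)
  then have 10: "S \<Turnstile> T10 \<longleftrightarrow>
      (\<forall>x\<in>M. \<forall>y\<in>M. (x, y) \<in> sib S \<or> (y, x) \<in> sib S \<longleftrightarrow>
        (\<exists>z. (z, x) \<in> child_rel M (desc S) \<and> (z, y) \<in> child_rel M (desc S)) \<and> x \<noteq> y)"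
    unfolding models_def T10_def
    by (simp add: const Iff_def del: sat.simps(10) flip: M_def) blast
  show ?thesis
    using assms unfolding discrete_tree_def is_structure_def ball_simps 1 2 3 4 5 6 7 8 9 10
    unfolding M_def Ball_def all_simps
    by (intro iffI conjI; elim conjE; assumption?) simp_all
qed

section \<open>Preorder traversal\<close>

text \<open>The nodes visited by the depth-first, left-to-right traversal up to and including \<open>v\<close>.\<close>

definition pre :: "'a tree_struct \<Rightarrow> 'a \<Rightarrow> 'a set" where
  "pre S v = {t \<in> univ S. (t, v) \<in> (desc S)\<^sup>= \<or>
     (\<exists>(a, b) \<in> sib S. (a, t) \<in> (desc S)\<^sup>= \<and> (b, v) \<in> (desc S)\<^sup>=)}"

text \<open>Only the inclusion is required, so that neither linearity of the traversal order nor uniqueness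
  of the successor has to be established.\<close>

definition step :: "'a tree_struct \<Rightarrow> ('a \<times> 'a) set" where
  "step S = {(u, v) \<in> univ S \<times> univ S. pre S v \<subseteq> insert v (pre S u)}"

text \<open>What remains to be visited below the parent of \<open>x\<close> once all earlier
  siblings are done. Later siblings are included so that the forest of a first child is everything
  properly below its parent.\<close>

definition forest :: "'a tree_struct \<Rightarrow> 'a \<Rightarrow> 'a set" where
  "forest S x = {t \<in> univ S. \<exists>y. (x, y) \<in> (sib S)\<^sup>= \<and> (y, t) \<in> (desc S)\<^sup>=}"

text \<open>The property to which Ind is applied. Keeping \<open>pre S x\<close> inside
  \<open>pre S z\<close> is what later justifies the step from the end of one subtree to the next
  sibling.\<close>

definition exhaustible :: "'a tree_struct \<Rightarrow> 'a \<Rightarrow> bool" where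
  "exhaustible S x \<longleftrightarrow>
     (\<exists>z\<in>univ S. (x, z) \<in> (step S)\<^sup>* \<and> pre S x \<union> forest S x \<subseteq> pre S z)"

lemma finite_pre_rtrancl_step:
  "(x, z) \<in> (step S)\<^sup>* \<Longrightarrow> finite (pre S x) \<Longrightarrow> finite (pre S z)"
proof (induction rule: rtrancl_induct)
  case (step u v)
  then have "pre S v \<subseteq> insert v (pre S u)" "finite (insert v (pre S u))"
    by (simp_all add: step_def)
  then show ?case by (rule finite_subset)
qed

context discrete_tree
begin

section \<open>Ancestors, parents and siblings\<close>

abbreviation ch where "ch \<equiv> child_rel (univ S) (desc S)"

lemma ch_desc: "(x, y) \<in> ch \<Longrightarrow> (x, y) \<in> desc S"
  by (simp add: child_rel_def)

lemma univI:
  "(x, y) \<in> desc S \<Longrightarrow> x \<in> univ S" "(x, y) \<in> desc S \<Longrightarrow> y \<in> univ S"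
  "(x, y) \<in> sib S \<Longrightarrow> x \<in> univ S" "(x, y) \<in> sib S \<Longrightarrow> y \<in> univ S"
  using desc_subset sib_subset by auto

lemma desc_not_refl [simp]: "(x, x) \<notin> desc S"
  using desc_irrefl by (simp add: irrefl_def)

lemma pre_descI: "(t, v) \<in> (desc S)\<^sup>= \<Longrightarrow> v \<in> univ S \<Longrightarrow> t \<in> pre S v"
  by (auto simp: pre_def dest: univI)

lemma pre_sibI:
  assumes "(a, b) \<in> sib S" "(a, t) \<in> (desc S)\<^sup>=" "(b, v) \<in> (desc S)\<^sup>="
  shows "t \<in> pre S v"
proof -
  have "t \<in> univ S" using assms univI by auto
  with assms show ?thesis unfolding pre_def by blast
qed

text \<open>As ancestors of \<open>x\<close>, the nodes \<open>t\<close> and \<open>p\<close> are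
  comparable, and \<open>t\<close> strictly between \<open>p\<close> and \<open>x\<close> would
  contradict that \<open>p\<close> is an immediate predecessor.\<close>

lemma ch_ancestor:
  assumes "(p, x) \<in> ch" "(t, x) \<in> desc S"
  shows "(t, p) \<in> (desc S)\<^sup>="
proof (rule ccontr)
  assume "(t, p) \<notin> (desc S)\<^sup>="
  then have "(p, t) \<in> desc S"
    using ancestors_linear[OF ch_desc[OF assms(1)] assms(2)] by auto
  with assms univI(1)[OF assms(2)] show False by (auto simp: child_rel_def)
qed

text \<open>Two distinct parents of \<open>x\<close> would each lie strictly above the
  other.\<close>

lemma ch_unique:
  assumes "(p, x) \<in> ch" "(q, x) \<in> ch"
  shows "p = q"
proof (rule ccontr)
  assume "p \<noteq> q"
  then have "(p, q) \<in> desc S" "(q, p) \<in> desc S"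
    using ch_ancestor[OF assms(2) ch_desc[OF assms(1)]]
      ch_ancestor[OF assms(1) ch_desc[OF assms(2)]] by auto
  then have "(p, p) \<in> desc S" by (rule transD[OF desc_trans])
  then show False by simp
qed

lemma sib_parent:
  assumes "(x, y) \<in> sib S"
  shows "\<exists>p. (p, x) \<in> ch \<and> (p, y) \<in> ch"
  using sib_iff[OF univI(3)[OF assms] univI(4)[OF assms]] assms by simp

text \<open>Siblings share a parent, and every proper ancestor of \<open>x\<close> is this parent or
  lies above it.\<close>

lemma desc_sib:
  assumes "(t, x) \<in> desc S" "(x, y) \<in> sib S \<or> (y, x) \<in> sib S"
  shows "(t, y) \<in> desc S"
proof -
  obtain p where p: "(p, x) \<in> ch" "(p, y) \<in> ch"
    using assms(2) sib_parent by blast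
  have "(t, p) \<in> (desc S)\<^sup>=" using p(1) assms(1) by (rule ch_ancestor)
  then show ?thesis using ch_desc[OF p(2)] by (auto intro: transD[OF desc_trans])
qed

text \<open>A common later sibling forces a common parent, and distinct children of one node are
  comparable by T10.\<close>

lemma sib_linear:
  assumes "(a, y) \<in> sib S" "(x, y) \<in> sib S"
  shows "(a, x) \<in> (sib S)\<^sup>= \<or> (x, a) \<in> sib S"
proof -
  obtain p where p: "(p, a) \<in> ch" "(p, y) \<in> ch" using sib_parent[OF assms(1)] by blast
  obtain q where q: "(q, x) \<in> ch" "(q, y) \<in> ch" using sib_parent[OF assms(2)] by blast
  have "p = q" using p(2) q(2) by (rule ch_unique)
  with p q show ?thesis using sib_iff[OF univI(3)[OF assms(1)] univI(3)[OF assms(2)]] by auto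
qed

text \<open>At a leaf \<open>z\<close> is \<open>x\<close> itself. Otherwise one step leads from
  \<open>x\<close> to its first child, whose exhaustibility covers all children of \<open>x\<close>
  with their subtrees.\<close>

lemma exhaustible_subtree:
  assumes x: "x \<in> univ S" and IH: "\<And>y. (x, y) \<in> desc S \<Longrightarrow> exhaustible S y"
  shows "\<exists>z\<in>univ S. (x, z) \<in> (step S)\<^sup>* \<and> pre S x \<union> {t. (x, t) \<in> (desc S)\<^sup>=} \<subseteq> pre S z"
proof (cases "\<exists>c. (x, c) \<in> desc S")
  case False
  then show ?thesis using x by (intro bexI[of _ x]) (auto simp: pre_def)
next
  case True
  then obtain c0 where c0: "(x, c0) \<in> ch" using desc_child by blast
  \<comment> \<open>T9 leads from an arbitrary child \<open>c0\<close> back to the first one among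
    its siblings, which has the same parent.\<close>
  obtain c where c: "(c, c0) \<in> (sib S)\<^sup>=" and first: "\<And>z. (z, c) \<notin> sib S"
    using sib_first ch_desc[OF c0] univI by metis
  have xc: "(x, c) \<in> ch" using c c0 sib_parent[of c c0] ch_unique by auto
  note xc' = ch_desc[OF xc]
  \<comment> \<open>Nothing precedes \<open>c\<close> among its siblings, and each proper ancestor
    of \<open>c\<close> is \<open>x\<close> or above it, so only \<open>c\<close> itself is
    new.\<close>
  have "pre S c \<subseteq> insert c (pre S x)"
    using ch_ancestor[OF xc] first by (fastforce simp: pre_def)
  then have "(x, c) \<in> step S" using x univI(2)[OF xc'] by (simp add: step_def)
  moreover obtain z where z: "z \<in> univ S" "(c, z) \<in> (step S)\<^sup>*" "pre S c \<union> forest S c \<subseteq> pre S z"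
    using IH[OF xc'] by (auto simp: exhaustible_def)
  moreover have "pre S x \<subseteq> pre S c"
    using xc' desc_trans by (fastforce simp: pre_def dest: transD)
  \<comment> \<open>By T3 each such \<open>t\<close> lies in the subtree of some child
    \<open>d\<close> of \<open>x\<close>; by T10 and the choice of \<open>c\<close>,
    \<open>d\<close> is \<open>c\<close> or a later sibling.\<close>
  moreover have "{t. (x, t) \<in> desc S} \<subseteq> forest S c"
  proof clarify
    fix t assume t: "(x, t) \<in> desc S"
    obtain d where d: "(x, d) \<in> ch" "(d, t) \<in> (desc S)\<^sup>=" using desc_child[OF t] by blast
    have "(c, d) \<in> (sib S)\<^sup>="
      using sib_iff[of c d] xc d(1) first univI(2)[OF xc'] univI(2)[OF ch_desc[OF d(1)]]
      by (metis Un_iff pair_in_Id_conv)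
    then show "t \<in> forest S c" using d univI(2)[OF t] by (auto simp: forest_def)
  qed
  moreover have "x \<in> pre S x" using x by (simp add: pre_def)
  ultimately show ?thesis
    by (intro bexI[of _ z]) (auto intro: converse_rtrancl_into_rtrancl)
qed

text \<open>First the subtree of \<open>x\<close> is exhausted, ending in \<open>z1\<close>. Without
  later siblings this is the whole forest; otherwise a single step leads from \<open>z1\<close> to
  the next sibling \<open>y\<close>, and the hypothesis for \<open>y\<close> covers the
  rest.\<close>

lemma exhaustible_progressive:
  assumes x: "x \<in> univ S" and IH: "\<And>y. (x, y) \<in> desc S \<union> sib S \<Longrightarrow> exhaustible S y"
  shows "exhaustible S x"
proof -
  obtain z1 where z1: "z1 \<in> univ S" "(x, z1) \<in> (step S)\<^sup>*"
    "pre S x \<union> {t. (x, t) \<in> (desc S)\<^sup>=} \<subseteq> pre S z1"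
    using exhaustible_subtree[OF x] IH by blast
  show ?thesis
  proof (cases "\<exists>y. (x, y) \<in> sib S")
    case False
    then have "forest S x \<subseteq> {t. (x, t) \<in> (desc S)\<^sup>=}" by (auto simp: forest_def)
    with z1 show ?thesis by (auto simp: exhaustible_def)
  next
    case True
    then obtain y where xy: "(x, y) \<in> sib S" and ns: "\<nexists>w. (x, w) \<in> sib S \<and> (w, y) \<in> sib S"
      using sib_next by blast
    \<comment> \<open>Everything visited by \<open>y\<close> is \<open>y\<close>, a common ancestor
      of \<open>x\<close> and \<open>y\<close>, something to the left of such an ancestor, or in the
      subtree of a sibling before \<open>y\<close>. All but \<open>y\<close> is in
      \<open>pre S x\<close> or the subtree of \<open>x\<close>.\<close>
    have "pre S y \<subseteq> insert y (pre S z1)"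
    proof
      fix t assume "t \<in> pre S y"
      then consider "t = y" | "(t, y) \<in> desc S"
        | a b where "(a, b) \<in> sib S" "(a, t) \<in> (desc S)\<^sup>=" "(b, y) \<in> desc S"
        | a where "(a, y) \<in> sib S" "(a, t) \<in> (desc S)\<^sup>="
        by (auto simp: pre_def)
      then show "t \<in> insert y (pre S z1)"
      proof cases
        case 1 then show ?thesis by simp
      next
        case 2
        then have "(t, x) \<in> desc S" using desc_sib xy by blast
        then have "t \<in> pre S x" using x by (auto intro: pre_descI)
        then show ?thesis using z1(3) by auto
      next
        case 3
        then have "(b, x) \<in> desc S" using desc_sib xy by blast
        with 3 have "t \<in> pre S x" by (auto intro: pre_sibI)
        then show ?thesis using z1(3) by auto
      next
        case 4
        \<comment> \<open>No sibling lies strictly between \<open>x\<close> and \<open>y\<close>, so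
          \<open>a\<close> is \<open>x\<close> or precedes it.\<close>
        then have "(a, x) \<in> (sib S)\<^sup>=" using sib_linear[OF 4(1) xy] ns by blast
        with 4 have "t \<in> pre S x \<union> {t. (x, t) \<in> (desc S)\<^sup>=}"
          by (auto intro: pre_sibI)
        then show ?thesis using z1(3) by auto
      qed
    qed
    then have "(z1, y) \<in> step S" using z1 univI xy by (simp add: step_def)
    moreover obtain z where z: "z \<in> univ S" "(y, z) \<in> (step S)\<^sup>*" "pre S y \<union> forest S y \<subseteq> pre S z"
      using IH[of y] xy by (auto simp: exhaustible_def)
    ultimately have "(x, z) \<in> (step S)\<^sup>*" using z1(2) by (meson rtrancl.rtrancl_into_rtrancl rtrancl_trans)
    moreover have subtree: "{t. (x, t) \<in> (desc S)\<^sup>=} \<subseteq> pre S y"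
      using xy by (auto intro: pre_sibI)
    moreover have "pre S x \<subseteq> pre S y"
    proof
      fix t assume "t \<in> pre S x"
      then consider "t = x" | "(t, x) \<in> desc S"
        | a b where "(a, b) \<in> sib S" "(a, t) \<in> (desc S)\<^sup>=" "(b, x) \<in> desc S" "t \<in> univ S"
        | a where "(a, x) \<in> sib S" "(a, t) \<in> (desc S)\<^sup>=" "t \<in> univ S"
        by (auto simp: pre_def)
      then show "t \<in> pre S y"
      proof cases
        case 1 then show ?thesis using subtree by auto
      next
        case 2
        then show ?thesis using desc_sib[of t x y] xy univI(4)[OF xy] by (auto intro: pre_descI)
      next
        case 3
        then show ?thesis using desc_sib[of b x y] xy by (auto intro: pre_sibI)
      next
        case 4
        then have "(a, y) \<in> sib S" using sib_trans xy by (meson transD)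
        with 4 show ?thesis by (auto intro: pre_sibI)
      qed
    qed
    moreover have "forest S x \<subseteq> {t. (x, t) \<in> (desc S)\<^sup>=} \<union> forest S y"
    proof
      fix t assume "t \<in> forest S x"
      then obtain w where w: "t \<in> univ S" "(x, w) \<in> (sib S)\<^sup>=" "(w, t) \<in> (desc S)\<^sup>="
        by (auto simp: forest_def)
      \<comment> \<open>The later siblings of \<open>x\<close> begin with \<open>y\<close>:
        \<open>w\<close> and \<open>y\<close> have the same parent, and \<open>ns\<close> excludes
        \<open>w\<close> before \<open>y\<close>.\<close>
      have "x = w \<or> (y, w) \<in> (sib S)\<^sup>="
      proof (cases "x = w")
        case False
        then have xw: "(x, w) \<in> sib S" using w by auto
        obtain p where "(p, x) \<in> ch" "(p, w) \<in> ch" using sib_parent[OF xw] by blast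
        moreover obtain q where "(q, x) \<in> ch" "(q, y) \<in> ch" using sib_parent[OF xy] by blast
        ultimately have "(p, y) \<in> ch" "(p, w) \<in> ch" using ch_unique by auto
        then show ?thesis using sib_iff[of y w] ns xw univI(4)[OF xy] univI(4)[OF xw] by blast
      qed simp
      then show "t \<in> {t. (x, t) \<in> (desc S)\<^sup>=} \<union> forest S y"
        using w by (auto simp: forest_def)
    qed
    ultimately show ?thesis using z unfolding exhaustible_def by blast
  qed
qed

section \<open>From exhaustibility to finite trees\<close>

lemma finite_univ:
  assumes "\<And>x. x \<in> univ S \<Longrightarrow> exhaustible S x"
  shows "finite (univ S)"
proof -
  obtain r where r: "r \<in> univ S" "\<And>x. x \<in> univ S \<Longrightarrow> (r, x) \<in> (desc S)\<^sup>=" using root by blast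
  \<comment> \<open>A proper ancestor of the root would give a cycle, and a sibling of it would give
    it a parent.\<close>
  have top: "(t, r) \<notin> desc S" for t
    using r(2)[of t] univI(1)[of t r] desc_trans desc_not_refl
    by (metis Un_iff pair_in_Id_conv transD)
  then have "(a, r) \<notin> sib S" for a
    using sib_parent[of a r] ch_desc by blast
  with top have "pre S r \<subseteq> {r}" by (auto simp: pre_def)
  then have fin: "finite (pre S r)" by (rule finite_subset) simp
  obtain z where z: "(r, z) \<in> (step S)\<^sup>*" "forest S r \<subseteq> pre S z"
    using assms[OF r(1)] by (auto simp: exhaustible_def)
  have "univ S \<subseteq> forest S r" using r(2) by (auto simp: forest_def)
  with finite_pre_rtrancl_step[OF z(1) fin] z(2) show ?thesis by (meson finite_subset)
qed

text \<open>Finiteness makes the converse of \<open>desc S\<close> well-founded, so moving from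
  \<open>x\<close> towards \<open>y\<close> child by child, as T3 allows, must arrive at
  \<open>y\<close>. Hence \<open>desc S\<close> is the transitive closure of the child
  relation.\<close>

lemma finite_tree_if_finite:
  assumes fin: "finite (univ S)"
  shows "finite_tree S"
proof -
  have "finite (desc S)" using fin desc_subset by (meson finite_SigmaI finite_subset)
  moreover have "acyclic (desc S)" using desc_trans desc_irrefl by (simp add: acyclic_irrefl)
  ultimately have wf: "wf ((desc S)\<inverse>)" by (rule finite_acyclic_wf_converse)
  have desc_ch: "(x, y) \<in> desc S \<longrightarrow> (x, y) \<in> ch\<^sup>+" for x y
    using wf
  proof (induction x rule: wf_induct_rule)
    case (less x)
    show ?case
    proof
      assume "(x, y) \<in> desc S"
      then obtain z where z: "(x, z) \<in> ch" "(z, y) \<in> (desc S)\<^sup>=" using desc_child by blast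
      then show "(x, y) \<in> ch\<^sup>+"
        using less[of z] ch_desc by (auto intro: trancl_into_trancl2)
    qed
  qed
  moreover have "ch\<^sup>+ \<subseteq> desc S"
  proof clarify
    fix a b assume "(a, b) \<in> ch\<^sup>+"
    then show "(a, b) \<in> desc S"
      by induction (auto dest: ch_desc transD[OF desc_trans])
  qed
  ultimately have eq: "desc S = ch\<^sup>+" by auto
  obtain r where r: "r \<in> univ S" "\<And>x. x \<in> univ S \<Longrightarrow> (r, x) \<in> (desc S)\<^sup>=" using root by blast
  then have is_root: "is_root (univ S) (desc S) r" by (auto simp: is_root_def)
  have "\<exists>!r. is_root (univ S) (desc S) r"
  proof (rule ex1I[of _ r], fact is_root)
    fix q assume "is_root (univ S) (desc S) q"
    then show "q = r" using is_root desc_trans desc_not_refl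
      unfolding is_root_def by (metis transD)
  qed
  \<comment> \<open>The parent is the last link of the chain of children leading from the root to
    \<open>x\<close>.\<close>
  moreover have "\<exists>!p. (p, x) \<in> ch" if "x \<in> univ S" "\<not> is_root (univ S) (desc S) x" for x
  proof -
    have "(r, x) \<in> ch\<^sup>+" using r(2)[OF that(1)] that(2) is_root desc_ch by auto
    then obtain p where "(p, x) \<in> ch" by (meson tranclD2)
    then show ?thesis using ch_unique by blast
  qed
  ultimately have "is_tree (univ S) (desc S)"
    unfolding is_tree_def using desc_irrefl desc_trans eq by blast
  moreover have "strict_linear_order_on (children S z) (sib S \<inter> children S z \<times> children S z)" for z
  proof -
    have "trans (sib S \<inter> children S z \<times> children S z)"
      using sib_trans unfolding trans_def by blast
    moreover have "irrefl (sib S \<inter> children S z \<times> children S z)"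
      using sib_irrefl unfolding irrefl_def by blast
    moreover have "total_on (children S z) (sib S \<inter> children S z \<times> children S z)"
      unfolding total_on_def children_def
      by (smt (verit) sib_iff univI(2) ch_desc IntI SigmaI mem_Collect_eq)
    ultimately show ?thesis by (simp add: strict_linear_order_on_def)
  qed
  moreover have "x \<noteq> y \<and> (\<exists>z\<in>univ S. x \<in> children S z \<and> y \<in> children S z)"
    if "(x, y) \<in> sib S" for x y
    using sib_iff[of x y] that univI ch_desc by (metis (mono_tags) children_def mem_Collect_eq)
  ultimately show ?thesis using fin by (auto simp: finite_tree_def)
qed

end

section \<open>Expressing exhaustibility in the three logics\<close>

text \<open>Bound variables are kept apart to avoid capture: 8 and 9 here, 7 in
  \<open>StepF\<close>, 6 in \<open>ForestF\<close>, 4 and 5 in \<open>ReachF\<close>. The endpoints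
  are 0 and 1, and 10 stays fresh for \<open>Ind\<close>.\<close>

definition PreF :: "nat \<Rightarrow> nat \<Rightarrow> fm" where
  "PreF t v = (Le t v \<^bold>\<or> Ex 8 (Ex 9 (Prec 8 9 \<^bold>\<and> Le 8 t \<^bold>\<and> Le 9 v)))"

definition StepF :: "nat \<Rightarrow> nat \<Rightarrow> fm" where
  "StepF u v = All 7 (PreF 7 v \<^bold>\<longrightarrow> Eq 7 v \<^bold>\<or> PreF 7 u)"

text \<open>The reflexive transitive closure of \<open>StepF\<close> from 0 to 1, the only
  ingredient that depends on the logic. The set variable 0 is of another sort than the element
  variable 0, and it occurs only positively under \<open>LFP\<close>.\<close>

definition ReachF :: "tree_logic \<Rightarrow> fm" where
  "ReachF L = (case L of
     MSO \<Rightarrow> AllSet 0 (Mem 0 0 \<^bold>\<and> All 4 (All 5 (Mem 0 4 \<^bold>\<and> StepF 4 5 \<^bold>\<longrightarrow> Mem 0 5)) \<^bold>\<longrightarrow> Mem 0 1)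
   | FO_TC1 \<Rightarrow> TC 4 5 (StepF 4 5) 0 1
   | FO_LFP1 \<Rightarrow> LFP 0 5 (Eq 5 0 \<^bold>\<or> Ex 4 (Mem 0 4 \<^bold>\<and> StepF 4 5)) 1)"

definition ForestF :: fm where
  "ForestF = Ex 6 (PrecEq 0 6 \<^bold>\<and> Le 6 7)"

definition ExhaustibleF :: "tree_logic \<Rightarrow> fm" where
  "ExhaustibleF L = Ex 1 (ReachF L \<^bold>\<and>
     All 7 (PreF 7 0 \<^bold>\<or> ForestF \<^bold>\<longrightarrow> PreF 7 1))"

lemmas formula_defs = PreF_def StepF_def ReachF_def ForestF_def ExhaustibleF_def Le_def PrecEq_def

lemma ExhaustibleF_wf:
  "is_formula L n (ExhaustibleF L)" "free_vars (ExhaustibleF L) \<subseteq> {0}"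
  "free_set_vars (ExhaustibleF L) = {}" "10 \<notin> vars (ExhaustibleF L)"
  by (cases L; auto simp: formula_defs)+

text \<open>The set of nodes reachable from \<open>x\<close> is the least closed set containing
  \<open>x\<close>, and it stays inside \<open>M\<close>. This is the common semantic form of the
  three versions of \<open>ReachF\<close>.\<close>

lemma rtrancl_iff_closed_sets:
  assumes "x \<in> M" "r \<subseteq> M \<times> M"
  shows "(x, y) \<in> r\<^sup>* \<longleftrightarrow> (\<forall>A\<subseteq>M. x \<in> A \<and> (\<forall>a b. a \<in> A \<and> (a, b) \<in> r \<longrightarrow> b \<in> A) \<longrightarrow> y \<in> A)"
proof
  assume "(x, y) \<in> r\<^sup>*"
  then show "\<forall>A\<subseteq>M. x \<in> A \<and> (\<forall>a b. a \<in> A \<and> (a, b) \<in> r \<longrightarrow> b \<in> A) \<longrightarrow> y \<in> A"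
    by (induction rule: rtrancl_induct) blast+
next
  assume *: "\<forall>A\<subseteq>M. x \<in> A \<and> (\<forall>a b. a \<in> A \<and> (a, b) \<in> r \<longrightarrow> b \<in> A) \<longrightarrow> y \<in> A"
  have "r\<^sup>* `` {x} \<subseteq> M"
    using assms by (auto elim: rtranclE)
  moreover have "\<forall>a b. a \<in> r\<^sup>* `` {x} \<and> (a, b) \<in> r \<longrightarrow> b \<in> r\<^sup>* `` {x}"
    by (auto intro: rtrancl_into_rtrancl)
  moreover have "x \<in> r\<^sup>* `` {x}" by simp
  ultimately show "(x, y) \<in> r\<^sup>*" using * by blast
qed

context discrete_tree
begin

lemma sat_PreF:
  assumes "t < 8" "v < 8" "g t \<in> univ S"
  shows "sat S g G (PreF t v) \<longleftrightarrow> g t \<in> pre S (g v)"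
  using assms sib_subset by (simp add: PreF_def pre_def Le_def) blast

lemma sat_StepF:
  assumes "u < 7" "v < 7" "g u \<in> univ S" "g v \<in> univ S"
  shows "sat S g G (StepF u v) \<longleftrightarrow> (g u, g v) \<in> step S"
  using assms by (auto simp: StepF_def sat_PreF step_def pre_def)

lemma sat_ReachF:
  assumes "g 0 \<in> univ S" "g 1 \<in> univ S"
  shows "sat S g G (ReachF L) \<longleftrightarrow> (g 0, g 1) \<in> (step S)\<^sup>*"
proof -
  have sub: "step S \<subseteq> univ S \<times> univ S" by (auto simp: step_def)
  show ?thesis
  proof (cases L)
    case MSO
    show ?thesis
      unfolding rtrancl_iff_closed_sets[OF assms(1) sub] using sub
      by (simp add: MSO ReachF_def sat_StepF) blast
  next
    case FO_TC1
    show ?thesis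
      unfolding rtrancl_iff_closed_sets[OF assms(1) sub] using sub
      by (simp add: FO_TC1 ReachF_def sat_StepF) blast
  next
    case FO_LFP1
    \<comment> \<open>A set closed under the body of the fixed point is exactly a set that contains
      the start node and is closed under steps.\<close>
    show ?thesis
      unfolding rtrancl_iff_closed_sets[OF assms(1) sub] using sub assms(1)
      by (simp add: FO_LFP1 ReachF_def sat_StepF) blast
  qed
qed

lemma sat_ForestF:
  assumes "g 0 \<in> univ S" "g 7 \<in> univ S"
  shows "sat S g G ForestF \<longleftrightarrow> g 7 \<in> forest S (g 0)"
  using assms sib_subset by (simp add: ForestF_def forest_def PrecEq_def Le_def) blast

lemma sat_ExhaustibleF:
  assumes "g 0 \<in> univ S"
  shows "sat S g G (ExhaustibleF L) \<longleftrightarrow> exhaustible S (g 0)"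
proof -
  have "sat S g G (ExhaustibleF L) \<longleftrightarrow> (\<exists>z\<in>univ S. (g 0, z) \<in> (step S)\<^sup>* \<and>
      (\<forall>t\<in>univ S. t \<in> pre S (g 0) \<or> t \<in> forest S (g 0) \<longrightarrow> t \<in> pre S z))"
    using assms by (simp add: ExhaustibleF_def sat_ReachF sat_PreF sat_ForestF)
  moreover have "pre S v \<subseteq> univ S" "forest S v \<subseteq> univ S" for v
    by (auto simp: pre_def forest_def)
  ultimately show ?thesis unfolding exhaustible_def by blast
qed

end

section \<open>Finite trees satisfy the axioms\<close>

text \<open>Unique parents make ancestors linearly ordered; well-foundedness of the finite sibling
  order supplies next and first siblings as minimal elements.\<close>

lemma finite_tree_discrete_tree:
  assumes str: "is_structure n S" and tree: "finite_tree S"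
  shows "discrete_tree S"
proof -
  let ?ch = "child_rel (univ S) (desc S)"
  have fin: "finite (univ S)" and irr: "irrefl (desc S)" and tr: "trans (desc S)"
    and eq: "desc S = ?ch\<^sup>+"
    and parent: "\<And>x. x \<in> univ S \<Longrightarrow> \<not> is_root (univ S) (desc S) x \<Longrightarrow> \<exists>!p. (p, x) \<in> ?ch"
    and lin: "\<And>z. z \<in> univ S \<Longrightarrow>
      strict_linear_order_on (children S z) (sib S \<inter> children S z \<times> children S z)"
    and sib': "\<And>x y. (x, y) \<in> sib S \<Longrightarrow> x \<noteq> y \<and> (\<exists>z\<in>univ S. (z, x) \<in> ?ch \<and> (z, y) \<in> ?ch)"
    using tree unfolding finite_tree_def is_tree_def children_def by auto
  obtain r where r: "is_root (univ S) (desc S) r"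
    using tree unfolding finite_tree_def is_tree_def by blast
  have dsub: "desc S \<subseteq> univ S \<times> univ S" and ssub: "sib S \<subseteq> univ S \<times> univ S"
    using str by (auto simp: is_structure_def)
  have ch_desc: "(x, y) \<in> ?ch \<Longrightarrow> (x, y) \<in> desc S" for x y by (simp add: child_rel_def)
  have root_top: "(p, x) \<notin> desc S" if "is_root (univ S) (desc S) x" for p x
  proof
    assume p: "(p, x) \<in> desc S"
    then have "p \<noteq> x" "p \<in> univ S" using irr dsub by (auto simp: irrefl_def)
    then have "(x, p) \<in> desc S" using that by (simp add: is_root_def)
    with p show False using tr irr by (meson irrefl_def transD)
  qed
  have ch_unique: "p = q" if "(p, x) \<in> ?ch" "(q, x) \<in> ?ch" for p q x
    using parent[of x] root_top[of x p] ch_desc[OF that(1)] that dsub by blast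
  \<comment> \<open>Each set of children is ordered separately, so a common parent of all three
    nodes is found first.\<close>
  have strans: "trans (sib S)"
  proof (rule transI)
    fix x y z assume xy: "(x, y) \<in> sib S" and yz: "(y, z) \<in> sib S"
    obtain p where p: "p \<in> univ S" "(p, x) \<in> ?ch" "(p, y) \<in> ?ch" using sib'[OF xy] by blast
    moreover have "(p, z) \<in> ?ch" using sib'[OF yz] p(3) ch_unique by blast
    ultimately show "(x, z) \<in> sib S"
      using lin[OF p(1)] xy yz unfolding strict_linear_order_on_def trans_def children_def
      by blast
  qed
  have sirr: "irrefl (sib S)" using sib' by (auto simp: irrefl_def)
  have "finite (sib S)" using fin ssub by (meson finite_SigmaI finite_subset)
  moreover have "acyclic (sib S)" using strans sirr by (simp add: acyclic_irrefl)
  ultimately have wfs: "wf (sib S)" by (rule finite_acyclic_wf)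
  have total: "(x, y) \<in> sib S \<or> (y, x) \<in> sib S" if "(z, x) \<in> ?ch" "(z, y) \<in> ?ch" "x \<noteq> y" for x y z
    using lin[of z] that dsub ch_desc[OF that(1)]
    unfolding strict_linear_order_on_def total_on_def children_def by blast
  show ?thesis
  proof
    show "desc S \<subseteq> univ S \<times> univ S" "sib S \<subseteq> univ S \<times> univ S" by fact+
    show "trans (desc S)" "irrefl (desc S)" "trans (sib S)" "irrefl (sib S)" by fact+
    show "\<exists>r\<in>univ S. \<forall>x\<in>univ S. (r, x) \<in> (desc S)\<^sup>=" using r by (auto simp: is_root_def)
  next
    fix x y assume "(x, y) \<in> desc S"
    then have "(x, y) \<in> ?ch\<^sup>+" using eq by blast
    then obtain z where "(x, z) \<in> ?ch" "(z, y) \<in> ?ch\<^sup>*" by (meson tranclD)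
    then show "\<exists>z. (x, z) \<in> ?ch \<and> (z, y) \<in> (desc S)\<^sup>="
      using eq by (metis reflcl_trancl)
  next
    fix x y z assume "(x, z) \<in> desc S" "(y, z) \<in> desc S"
    then have "(z, x) \<in> (?ch\<inverse>)\<^sup>*" "(z, y) \<in> (?ch\<inverse>)\<^sup>*"
      using eq by (metis converse_iff rtrancl_converse trancl_into_rtrancl)+
    \<comment> \<open>Moving to the parent is a partial function, so of two upward paths from
      \<open>z\<close> one extends the other.\<close>
    moreover have "single_valued (?ch\<inverse>)" using ch_unique by (auto simp: single_valued_def)
    ultimately have "(x, y) \<in> (?ch\<inverse>)\<^sup>* \<or> (y, x) \<in> (?ch\<inverse>)\<^sup>*" using single_valued_confluent by fast
    then show "(x, y) \<in> (desc S)\<^sup>= \<or> (y, x) \<in> (desc S)\<^sup>="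
      using eq by (metis converse_iff rtrancl_converse reflcl_trancl)
  next
    fix x y assume xy: "(x, y) \<in> sib S"
    \<comment> \<open>A minimal later sibling of \<open>x\<close> is its next sibling.\<close>
    obtain z where z: "(x, z) \<in> sib S" "\<And>w. (w, z) \<in> sib S \<Longrightarrow> (x, w) \<notin> sib S"
      using iffD1[OF wf_eq_minimal wfs, rule_format, of y "sib S `` {x}"] xy by auto
    have "(z, y) \<in> (sib S)\<^sup>="
    proof (cases "z = y")
      case False
      obtain p where "(p, x) \<in> ?ch" "(p, z) \<in> ?ch" using sib'[OF z(1)] by blast
      then have "(p, y) \<in> ?ch" "(p, z) \<in> ?ch" using sib'[OF xy] ch_unique by blast+
      then show ?thesis using total[of p z y] z(2) xy False by blast
    qed simp
    with z show "\<exists>z. (x, z) \<in> sib S \<and> (\<nexists>w. (x, w) \<in> sib S \<and> (w, z) \<in> sib S) \<and> (z, y) \<in> (sib S)\<^sup>="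
      by blast
  next
    fix x assume "x \<in> univ S"
    obtain z where z: "(z, x) \<in> (sib S)\<^sup>=" "\<And>w. (w, z) \<in> sib S \<Longrightarrow> (w, x) \<notin> (sib S)\<^sup>="
      using iffD1[OF wf_eq_minimal wfs, rule_format, of x "((sib S)\<^sup>=)\<inverse> `` {x}"] by auto
    \<comment> \<open>By transitivity, anything before \<open>z\<close> would be among the earlier
      siblings of \<open>x\<close>, against minimality.\<close>
    then have "\<nexists>w. (w, z) \<in> sib S" using strans by (metis Un_iff pair_in_Id_conv transD)
    with z(1) show "\<exists>y. (y, x) \<in> (sib S)\<^sup>= \<and> (\<nexists>z. (z, y) \<in> sib S)" by blast
  next
    fix x y assume "x \<in> univ S" "y \<in> univ S"
    show "(x, y) \<in> sib S \<or> (y, x) \<in> sib S \<longleftrightarrow> (\<exists>z. (z, x) \<in> ?ch \<and> (z, y) \<in> ?ch) \<and> x \<noteq> y"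
      using sib' total by blast
  qed
qed

section \<open>Converse well-foundedness and the induction scheme\<close>

context discrete_tree
begin

text \<open>By \<open>desc_sib\<close>, composing \<open>desc S\<close> with \<open>sib S\<close>
  stays in \<open>desc S\<close>, so the union of the two well-founded relations is well-founded.
  Being finite and acyclic, it has a well-founded converse too.\<close>

lemma wf_desc_Un_sib:
  assumes "finite (univ S)"
  shows "wf ((desc S \<union> sib S)\<inverse>)"
proof -
  have fin: "finite (desc S)" "finite (sib S)"
    using assms desc_subset sib_subset by (meson finite_SigmaI finite_subset)+
  have "wf (desc S)" "wf (sib S)"
    using fin desc_trans desc_irrefl sib_trans sib_irrefl
    by (auto intro!: finite_acyclic_wf simp: acyclic_irrefl)
  moreover have "desc S O sib S \<subseteq> desc S" using desc_sib by blast
  ultimately have "wf (desc S \<union> sib S)" by (rule wf_union_compatible)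
  then show ?thesis using fin by (intro finite_acyclic_wf_converse wf_acyclic) auto
qed

lemma models_Ind:
  assumes "finite (univ S)" "y \<noteq> x" "y \<notin> vars \<phi>"
  shows "S \<Turnstile> Ind x y \<phi>"
proof -
  have "sat S (g(x := a)) G \<phi>"
    if step: "\<And>a. a \<in> univ S \<Longrightarrow> (\<And>b. b \<in> univ S \<Longrightarrow> (a, b) \<in> desc S \<union> sib S
      \<Longrightarrow> sat S (g(x := b)) G \<phi>) \<Longrightarrow> sat S (g(x := a)) G \<phi>" and "a \<in> univ S" for g G a
    using wf_desc_Un_sib[OF assms(1)] \<open>a \<in> univ S\<close>
  proof (induction a rule: wf_induct_rule)
    case (less a)
    show ?case
    proof (rule step[OF less.prems])
      fix b assume "b \<in> univ S" "(a, b) \<in> desc S \<union> sib S"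
      then show "sat S (g(x := b)) G \<phi>" by (intro less.IH) simp_all
    qed
  qed
  then show ?thesis unfolding models_def sat_Ind[OF assms(2,3)] by blast
qed

end

section \<open>The axioms characterise finite trees\<close>

theorem theorem6p7:
  fixes L :: tree_logic and n :: nat and S :: "'a tree_struct"
  assumes "is_structure n S"
  shows "(\<forall>\<psi>\<in>tree_axioms L n. S \<Turnstile> \<psi>) \<longleftrightarrow> finite_tree S"
proof
  assume ax: "\<forall>\<psi>\<in>tree_axioms L n. S \<Turnstile> \<psi>"
  then have "discrete_tree S"
    using models_first_order_axioms[OF assms] by (simp add: tree_axioms_def)
  then interpret discrete_tree S .
  have "Ind 0 10 (ExhaustibleF L) \<in> tree_axioms L n"
    using ExhaustibleF_wf[of L] unfolding tree_axioms_def by fastforce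
  with ax have ind: "S \<Turnstile> Ind 0 10 (ExhaustibleF L)" by blast
  \<comment> \<open>Some node is needed as the value of every variable; the instance of Ind is a
    sentence, so any node serves.\<close>
  obtain m where "m \<in> univ S" using root by blast
  with ind have "sat S (\<lambda>_. m) (\<lambda>_. {}) (Ind 0 10 (ExhaustibleF L))" by (simp add: models_def)
  then have "(\<forall>a\<in>univ S. (\<forall>b\<in>univ S. (a, b) \<in> desc S \<union> sib S \<longrightarrow> exhaustible S b)
        \<longrightarrow> exhaustible S a)
      \<longrightarrow> (\<forall>a\<in>univ S. exhaustible S a)"
    by (simp add: sat_Ind ExhaustibleF_wf(4) sat_ExhaustibleF)
  moreover have "\<forall>a\<in>univ S. (\<forall>b\<in>univ S. (a, b) \<in> desc S \<union> sib S \<longrightarrow> exhaustible S b)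
      \<longrightarrow> exhaustible S a"
    using exhaustible_progressive univI by blast
  ultimately have "\<forall>a\<in>univ S. exhaustible S a" by (rule mp)
  then have "finite (univ S)" using finite_univ by blast
  then show "finite_tree S" by (rule finite_tree_if_finite)
next
  assume tree: "finite_tree S"
  then interpret discrete_tree S by (rule finite_tree_discrete_tree[OF assms])
  have "S \<Turnstile> \<psi>" if "\<psi> \<in> {T1, T2, T3, T4, T5, T6, T7, T8, T9, T10}" for \<psi>
    using models_first_order_axioms[OF assms] discrete_tree_axioms that by blast
  moreover have "finite (univ S)" using tree by (simp add: finite_tree_def)
  ultimately show "\<forall>\<psi>\<in>tree_axioms L n. S \<Turnstile> \<psi>"
    unfolding tree_axioms_def using models_Ind by blast
qed

end
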